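(* The tensor product $\mathcal{A} \otimes \mathcal{B}$ is an HDA model of the interleaving $\mathcal{S} \mathbin{|||} \mathcal{T}$.
   Context: $\mathcal{S}$ and $\mathcal{T}$ are $\ltimes$-transition systems (transition systems, i.e. 1-truncated HDAs in which two edges with the same label and endpoints are equal, together with a relation $\ltimes$ on labels), and $\mathcal{A}$, $\mathcal{B}$ are HDA models of $\mathcal{S}$, $\mathcal{T}$. An HDA $\mathcal{A}$ is an HDA model of a $\ltimes$-transition system $\mathcal{T}$ if: (HM1) $\mathcal{A}_{\le1}=U(\mathcal{T})$; (HM2) for all 2-cubes $x$, $\lambda_\mathcal{A}(d^0_2x)\ltimes_\mathcal{T}\lambda_\mathcal{A}(d^0_1x)$; (HM3) for $m\ge2$, two $m$-cubes with all the same faces $d^k_r$ are equal; (HM4) $\mathcal{A}$ is not a proper subautomaton of any HDA satisfying HM1–HM3. $\mathcal{A}\otimes\mathcal{B}$ is the tensor product of HDAs (tensor product of precubical sets, initial state $(I_\mathcal{A},I_\mathcal{B})$, final states $F_\mathcal{A}\times F_\mathcal{B}$, labels $\Sigma_\mathcal{A}\amalg\Sigma_\mathcal{B}$, edge $(x,y)$ labeled by the label of its 1-dimensional component). $\mathcal{S}\mathbin{|||}\mathcal{T}$ is the interleaving: underlying transition system $(U(\mathcal{S})\otimes U(\mathcal{T}))_{\le1}$, with $\alpha\ltimes\beta$ iff either $\alpha,\beta\in\Sigma_\mathcal{S}$ and $\alpha\ltimes_\mathcal{S}\beta$, or $\alpha,\beta\in\Sigma_\mathcal{T}$ and $\alpha\ltimes_\mathcal{T}\beta$,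 or $\alpha\in\Sigma_\mathcal{S}$ and $\beta\in\Sigma_\mathcal{T}$. *)

theory Defs
  imports Main "HOL-Library.Z2"
begin

text \<open>
  A graded set \<open>(P\<^sub>n)\<close> is represented by its disjoint union \<open>cubes\<close> together with the degree
  function \<open>deg\<close>.  \<open>bd A k i x\<close> is the face \<open>d\<^sup>k\<^sub>i x\<close>, with \<open>k\<close> in the two-element
  type \<open>bit\<close> and \<open>i\<close> in \<open>{1..deg x}\<close>.  Values of \<open>deg\<close>, \<open>bd\<close> and \<open>lab\<close> outside these domains
  (for \<open>lab\<close>: outside the edges) are irrelevant, and no notion below depends on them.
\<close>

record ('a, 'l) hda =
  cubes  :: "'a set"
  deg    :: "'a \<Rightarrow> nat"
  bd     :: "bit \<Rightarrow> nat \<Rightarrow> 'a \<Rightarrow> 'a"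
  init   :: 'a
  final  :: "'a set"
  labels :: "'l set"
  lab    :: "'a \<Rightarrow> 'l"

definition ncubes :: "('a, 'l) hda \<Rightarrow> nat \<Rightarrow> 'a set" where
  "ncubes A n = {x \<in> cubes A. deg A x = n}"

definition precubical :: "('a, 'l) hda \<Rightarrow> bool" where
  "precubical A \<longleftrightarrow>
     (\<forall>n. \<forall>x \<in> ncubes A n. \<forall>k. \<forall>i \<in> {1..n}. bd A k i x \<in> ncubes A (n - 1)) \<and>
     (\<forall>n. \<forall>x \<in> ncubes A n. \<forall>k l i j. 1 \<le> i \<and> i < j \<and> j \<le> n \<longrightarrow>
        bd A k i (bd A l j x) = bd A l (j - 1) (bd A k i x))"

definition is_hda :: "('a, 'l) hda \<Rightarrow> bool" where
  "is_hda A \<longleftrightarrow>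
     precubical A \<and>
     init A \<in> ncubes A 0 \<and>
     final A \<subseteq> ncubes A 0 \<and>
     (\<forall>x \<in> ncubes A 1. lab A x \<in> labels A) \<and>
     (\<forall>x \<in> ncubes A 2. \<forall>i \<in> {1, 2}. lab A (bd A 0 i x) = lab A (bd A 1 i x))"

definition subautomaton :: "('a, 'l) hda \<Rightarrow> ('a, 'l) hda \<Rightarrow> bool" where
  "subautomaton A B \<longleftrightarrow>
     cubes A \<subseteq> cubes B \<and>
     (\<forall>x \<in> cubes A. deg A x = deg B x) \<and>
     (\<forall>x \<in> cubes A. \<forall>k. \<forall>i \<in> {1..deg A x}. bd A k i x = bd B k i x) \<and>
     init A = init B \<and>
     final A \<subseteq> final B \<and>
     labels A \<subseteq> labels B \<and>
     (\<forall>x \<in> ncubes A 1. lab A x = lab B x)"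

text \<open>
  Equality of HDAs; record equality would also compare the irrelevant values.
\<close>

definition hda_eq :: "('a, 'l) hda \<Rightarrow> ('a, 'l) hda \<Rightarrow> bool" where
  "hda_eq A B \<longleftrightarrow> subautomaton A B \<and> subautomaton B A"

definition proper_subautomaton :: "('a, 'l) hda \<Rightarrow> ('a, 'l) hda \<Rightarrow> bool" where
  "proper_subautomaton A B \<longleftrightarrow> subautomaton A B \<and> \<not> hda_eq A B"

definition trunc :: "nat \<Rightarrow> ('a, 'l) hda \<Rightarrow> ('a, 'l) hda" where
  "trunc n A = A\<lparr>cubes := {x \<in> cubes A. deg A x \<le> n}\<rparr>"

definition transition_system :: "('a, 'l) hda \<Rightarrow> bool" where
  "transition_system A \<longleftrightarrow>
     is_hda A \<and>
     (\<forall>x \<in> cubes A. deg A x \<le> 1) \<and>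
     (\<forall>x \<in> ncubes A 1. \<forall>y \<in> ncubes A 1.
        bd A 0 1 x = bd A 0 1 y \<and> bd A 1 1 x = bd A 1 1 y \<and> lab A x = lab A y \<longrightarrow> x = y)"

record ('a, 'l) lts =
  U      :: "('a, 'l) hda"
  ltimes :: "('l \<times> 'l) set"

definition ltimes_transition_system :: "('a, 'l) lts \<Rightarrow> bool" where
  "ltimes_transition_system T \<longleftrightarrow>
     transition_system (U T) \<and> ltimes T \<subseteq> labels (U T) \<times> labels (U T)"

definition HM1 :: "('a, 'l) hda \<Rightarrow> ('a, 'l) lts \<Rightarrow> bool" where
  "HM1 A T \<longleftrightarrow> hda_eq (trunc 1 A) (U T)"

definition HM2 :: "('a, 'l) hda \<Rightarrow> ('a, 'l) lts \<Rightarrow> bool" where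
  "HM2 A T \<longleftrightarrow> (\<forall>x \<in> ncubes A 2. (lab A (bd A 0 2 x), lab A (bd A 0 1 x)) \<in> ltimes T)"

definition HM3 :: "('a, 'l) hda \<Rightarrow> bool" where
  "HM3 A \<longleftrightarrow> (\<forall>m \<ge> 2. \<forall>x \<in> ncubes A m. \<forall>y \<in> ncubes A m.
     (\<forall>k. \<forall>r \<in> {1..m}. bd A k r x = bd A k r y) \<longrightarrow> x = y)"

text \<open>
  In HM4 an HDA is compared with \<^emph>\<open>arbitrary\<close> larger HDAs, whose additional cubes need not fit into
  the part of \<open>'a\<close> that \<open>A\<close> leaves unused (possibly none of it).  The larger HDAs are
  therefore taken over \<open>'a + 'x\<close>, where \<open>A\<close> is regarded as an HDA along \<open>Inl\<close>.  The type
  \<open>'x\<close> is a universe parameter.  Since it is nonempty, its choice does not affect the notion: given a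
  larger HDA satisfying HM1, HM2 and HM3, \<open>A\<close> together with a single additional cube of least
  possible degree (which is at least 2) already satisfies them.
\<close>

definition lift_hda :: "('a, 'l) hda \<Rightarrow> ('a + 'x, 'l) hda" where
  "lift_hda A =
     \<lparr>cubes  = Inl ` cubes A,
      deg    = (\<lambda>z. deg A (projl z)),
      bd     = (\<lambda>k i z. Inl (bd A k i (projl z))),
      init   = Inl (init A),
      final  = Inl ` final A,
      labels = labels A,
      lab    = (\<lambda>z. lab A (projl z))\<rparr>"

definition lift_lts :: "('a, 'l) lts \<Rightarrow> ('a + 'x, 'l) lts" where
  "lift_lts T = \<lparr>U = lift_hda (U T), ltimes = ltimes T\<rparr>"

definition HM4 :: "'x itself \<Rightarrow> ('a, 'l) hda \<Rightarrow> ('a, 'l) lts \<Rightarrow> bool" where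
  "HM4 X A T \<longleftrightarrow>
     \<not> (\<exists>C :: ('a + 'x, 'l) hda.
           is_hda C \<and> HM1 C (lift_lts T) \<and> HM2 C (lift_lts T) \<and> HM3 C \<and>
           proper_subautomaton (lift_hda A) C)"

definition hda_model :: "'x itself \<Rightarrow> ('a, 'l) hda \<Rightarrow> ('a, 'l) lts \<Rightarrow> bool" where
  "hda_model X A T \<longleftrightarrow>
     ltimes_transition_system T \<and> is_hda A \<and> HM1 A T \<and> HM2 A T \<and> HM3 A \<and> HM4 X A T"

definition tensor :: "('a, 'l) hda \<Rightarrow> ('b, 'm) hda \<Rightarrow> ('a \<times> 'b, 'l + 'm) hda"
    (infixr \<open>\<otimes>\<close> 70) where
  "A \<otimes> B =
     \<lparr>cubes  = cubes A \<times> cubes B,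
      deg    = (\<lambda>(x, y). deg A x + deg B y),
      bd     = (\<lambda>k i (x, y).
                  if i \<le> deg A x then (bd A k i x, y) else (x, bd B k (i - deg A x) y)),
      init   = (init A, init B),
      final  = final A \<times> final B,
      labels = labels A <+> labels B,
      lab    = (\<lambda>(x, y). if deg A x = 1 then Inl (lab A x) else Inr (lab B y))\<rparr>"

definition interleaving :: "('a, 'l) lts \<Rightarrow> ('b, 'm) lts \<Rightarrow> ('a \<times> 'b, 'l + 'm) lts"
    (infixr \<open>|||\<close> 65) where
  "S ||| T =
     \<lparr>U      = trunc 1 (U S \<otimes> U T),
      ltimes = {(Inl \<alpha>, Inl \<beta>) | \<alpha> \<beta>. (\<alpha>, \<beta>) \<in> ltimes S} \<union>
               {(Inr \<alpha>, Inr \<beta>) | \<alpha> \<beta>. (\<alpha>, \<beta>) \<in> ltimes T} \<union>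
               {(Inl \<alpha>, Inr \<beta>) | \<alpha> \<beta>. \<alpha> \<in> labels (U S) \<and> \<beta> \<in> labels (U T)}\<rparr>"

end

theory Submission
  imports Defs
begin

text \<open>
  Call a family of faces with the incidences and labels of the boundary of an \<open>m\<close>-cube a shell.
  Given HM1, HM2 and HM3, condition HM4 says that every shell of dimension at least 2 is filled: an
  unfilled shell could be filled by a new cube, and conversely a cube of least degree in a proper
  extension has its boundary in the smaller automaton.

  It remains to fill a shell of \<open>A \<otimes> B\<close>. The bidegrees of its faces are those of the faces of a
  \<open>(p, q)\<close>-cube; this is arithmetic for \<open>m \<ge> 3\<close>, and for \<open>m = 2\<close> it holds because no
  label of \<open>T\<close> is related by \<open>\<ltimes>\<close> to a label of \<open>S\<close>. If \<open>q = 0\<close> or \<open>p = 0\<close>, the shell is filled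
  in \<open>A\<close> or \<open>B\<close>. Otherwise the first components of the faces in the last \<open>q\<close> directions all coincide,
  by HM3 in \<open>A\<close> or because edges are determined by their endpoints and label, and so do the second
  components in the first \<open>p\<close> directions; these two cubes form the filler.
\<close>

section \<open>Shells, their fillings, and edges determined by endpoints and label\<close>

text \<open>\<open>f k i\<close> is the prospective face \<open>d^k_i\<close>. Labels are
  constrained only for \<open>m = 2\<close>, because the label axiom of an HDA and HM2 both concern
  2-cubes alone; \<open>R\<close> stands for the relation in HM2.\<close>

definition shell :: "('a, 'l) hda \<Rightarrow> ('l \<times> 'l) set \<Rightarrow> nat \<Rightarrow> (bit \<Rightarrow> nat \<Rightarrow> 'a) \<Rightarrow> bool" where
  "shell A R m f \<longleftrightarrow>
     (\<forall>k. \<forall>i \<in> {1..m}. f k i \<in> ncubes A (m - 1)) \<and>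
     (\<forall>k l i j. 1 \<le> i \<and> i < j \<and> j \<le> m \<longrightarrow> bd A k i (f l j) = bd A l (j - 1) (f k i)) \<and>
     (m = 2 \<longrightarrow> (\<forall>i \<in> {1, 2}. lab A (f 0 i) = lab A (f 1 i)) \<and>
        (lab A (f 0 2), lab A (f 0 1)) \<in> R)"

definition fills :: "('a, 'l) hda \<Rightarrow> ('l \<times> 'l) set \<Rightarrow> bool" where
  "fills A R \<longleftrightarrow> (\<forall>m \<ge> 2. \<forall>f. shell A R m f \<longrightarrow>
     (\<exists>x \<in> ncubes A m. \<forall>k. \<forall>i \<in> {1..m}. bd A k i x = f k i))"

text \<open>The uniqueness clause of \<open>transition_system\<close>, separated from the degree
  bound so that it can be asserted of an HDA with higher cubes.\<close>

definition edges_determined :: "('a, 'l) hda \<Rightarrow> bool" where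
  "edges_determined A \<longleftrightarrow> (\<forall>x \<in> ncubes A 1. \<forall>y \<in> ncubes A 1.
     bd A 0 1 x = bd A 0 1 y \<and> bd A 1 1 x = bd A 1 1 y \<and> lab A x = lab A y \<longrightarrow> x = y)"

lemma bd_ncubes:
  "precubical A \<Longrightarrow> x \<in> ncubes A n \<Longrightarrow> 1 \<le> i \<Longrightarrow> i \<le> n \<Longrightarrow> bd A k i x \<in> ncubes A (n - 1)"
  by (auto simp: precubical_def)

lemma bd_bd:
  "precubical A \<Longrightarrow> x \<in> ncubes A n \<Longrightarrow> 1 \<le> i \<Longrightarrow> i < j \<Longrightarrow> j \<le> n \<Longrightarrow>
     bd A k i (bd A l j x) = bd A l (j - 1) (bd A k i x)"
  by (auto simp: precubical_def)

lemma is_hda_precubical: "is_hda A \<Longrightarrow> precubical A"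
  by (simp add: is_hda_def)

text \<open>The two inclusions in \<open>hda_eq\<close> merge into equalities, restricted to the
  arguments where the fields are meaningful.\<close>

lemma HM1_iff:
  "HM1 A T \<longleftrightarrow>
     (\<forall>x. x \<in> cubes (U T) \<longleftrightarrow> x \<in> cubes A \<and> deg A x \<le> 1) \<and>
     (\<forall>x \<in> cubes (U T). deg A x = deg (U T) x) \<and>
     (\<forall>x \<in> cubes (U T). \<forall>k. \<forall>i \<in> {1..deg A x}. bd A k i x = bd (U T) k i x) \<and>
     init A = init (U T) \<and> final A = final (U T) \<and> labels A = labels (U T) \<and>
     (\<forall>x \<in> ncubes (U T) 1. lab A x = lab (U T) x)"
  (is "_ \<longleftrightarrow> ?R")
proof
  assume "HM1 A T"
  then have sub: "subautomaton (trunc 1 A) (U T)" "subautomaton (U T) (trunc 1 A)"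
    by (auto simp: HM1_def hda_eq_def)
  have "x \<in> cubes (U T) \<longleftrightarrow> x \<in> cubes A \<and> deg A x \<le> 1" for x
    using sub unfolding subautomaton_def trunc_def by auto
  moreover have "deg A x = deg (U T) x" if "x \<in> cubes (U T)" for x
    using sub(2) that unfolding subautomaton_def trunc_def by auto
  ultimately show ?R
    using sub unfolding subautomaton_def trunc_def ncubes_def by (simp add: set_eq_subset)
next
  assume ?R
  then have "cubes (U T) = {x \<in> cubes A. deg A x \<le> 1}" by blast
  then show "HM1 A T"
    using \<open>?R\<close> unfolding HM1_def hda_eq_def subautomaton_def trunc_def ncubes_def by simp
qed

text \<open>Edges survive the truncation, so HM1 identifies them, their faces and their labels with
  those of \<open>U T\<close>, where uniqueness is known.\<close>

lemma HM1_edges_determined: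
  assumes "transition_system (U T)" "HM1 A T"
  shows "edges_determined A"
proof -
  have "x \<in> ncubes (U T) 1 \<and> bd A k 1 x = bd (U T) k 1 x \<and> lab A x = lab (U T) x"
    if "x \<in> ncubes A 1" for x k
  proof -
    have "x \<in> cubes (U T)" "deg A x = 1"
      using that assms(2) by (auto simp: HM1_iff ncubes_def)
    moreover from this have "x \<in> ncubes (U T) 1"
      using assms(2) unfolding HM1_iff ncubes_def by (metis (mono_tags, lifting) mem_Collect_eq)
    ultimately show ?thesis
      using assms(2) unfolding HM1_iff by simp
  qed
  then show ?thesis
    using assms(1) unfolding edges_determined_def transition_system_def by metis
qed

section \<open>HM4 as a filling condition\<close>

text \<open>An unfilled shell is glued in as the boundary of one new cube. The shell conditions give
  the HDA axioms and HM2 for the extension, \<open>2 <= m\<close> preserves HM1, and the absence of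
  a filler preserves HM3, which contradicts HM4.\<close>

lemma HM4_fills:
  fixes A :: "('a, 'l) hda" and T :: "('a, 'l) lts"
  assumes A: "is_hda A" and hm1: "HM1 A T" and hm2: "HM2 A T" and hm3: "HM3 A"
    and hm4: "HM4 TYPE('x) A T"
  shows "fills A (ltimes T)"
  unfolding fills_def
proof (intro allI impI; rule ccontr)
  fix m f
  assume m: "2 \<le> m" and f: "shell A (ltimes T) m f"
    and nofill: "\<not> (\<exists>x \<in> ncubes A m. \<forall>k. \<forall>i \<in> {1..m}. bd A k i x = f k i)"
  \<comment> \<open>Any element of the right summand may serve as the new cube; it cannot collide
    with a cube of \<open>A\<close>.\<close>
  define e :: "'a + 'x" where "e = Inr undefined"
  define C :: "('a + 'x, 'l) hda" where
    "C = (lift_hda A)\<lparr>cubes := insert e (Inl ` cubes A),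
            deg := (\<lambda>z. case z of Inl a \<Rightarrow> deg A a | Inr _ \<Rightarrow> m),
            bd := (\<lambda>k i z. case z of Inl a \<Rightarrow> Inl (bd A k i a) | Inr _ \<Rightarrow> Inl (f k i))\<rparr>"
  have nc: "ncubes C n = Inl ` ncubes A n \<union> (if n = m then {e} else {})" for n
    by (auto simp: ncubes_def C_def e_def)
  have bdC [simp]: "bd C k i (Inl x) = Inl (bd A k i x)" "bd C k i e = Inl (f k i)" for k i x
    by (auto simp: C_def e_def)
  have labC [simp]: "lab C (Inl x) = lab A x" "labels C = labels A"
    "final C = Inl ` final A" "init C = Inl (init A)" for x
    by (auto simp: C_def e_def lift_hda_def)
  note fD = f[unfolded shell_def]
  have pre: "precubical C"
    using fD m is_hda_precubical[OF A] unfolding precubical_def nc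
    by (auto split: if_splits)
  have "is_hda C"
    using A pre fD m unfolding is_hda_def nc by auto
  moreover have "HM1 C (lift_lts T)"
  proof -
    have "x \<in> cubes (U (lift_lts T)) \<longleftrightarrow> x \<in> cubes C \<and> deg C x \<le> 1" for x
      using hm1 m unfolding HM1_iff lift_lts_def by (cases x) (auto simp: C_def e_def lift_hda_def)
    then show ?thesis
      using hm1 m unfolding HM1_iff lift_lts_def
      by (auto simp: C_def e_def lift_hda_def ncubes_def)
  qed
  moreover have "HM2 C (lift_lts T)"
    using hm2 fD unfolding HM2_def nc by (auto simp: lift_lts_def)
  moreover have "HM3 C"
    unfolding HM3_def
  proof (intro allI impI ballI)
    fix n x y
    assume n: "2 \<le> n" and x: "x \<in> ncubes C n" and y: "y \<in> ncubes C n"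
      and eq: "\<forall>k. \<forall>r\<in>{1..n}. bd C k r x = bd C k r y"
    \<comment> \<open>Two old cubes are handled by HM3 of \<open>A\<close>; an old cube with the
      same faces as \<open>e\<close> would fill the shell.\<close>
    consider (old) a b where "x = Inl a" "y = Inl b" "a \<in> ncubes A n" "b \<in> ncubes A n"
      | (new) "x = e" "y = e"
      | (xnew) b where "n = m" "x = e" "y = Inl b" "b \<in> ncubes A n"
      | (ynew) a where "n = m" "y = e" "x = Inl a" "a \<in> ncubes A n"
      using x y unfolding nc by (auto split: if_splits)
    then show "x = y"
    proof cases
      case old
      then show ?thesis using hm3 eq n unfolding HM3_def by auto
    next
      case xnew
      then have "\<forall>k. \<forall>i\<in>{1..m}. bd A k i b = f k i" using eq by auto
      then show ?thesis using nofill xnew by blast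
    next
      case ynew
      then have "\<forall>k. \<forall>i\<in>{1..m}. bd A k i a = f k i" using eq by auto
      then show ?thesis using nofill ynew by blast
    qed auto
  qed
  moreover have "proper_subautomaton (lift_hda A) C"
  proof -
    have "subautomaton (lift_hda A) C"
      unfolding subautomaton_def by (auto simp: C_def lift_hda_def ncubes_def)
    moreover have "\<not> subautomaton C (lift_hda A)"
      unfolding subautomaton_def by (auto simp: C_def lift_hda_def e_def)
    ultimately show ?thesis by (simp add: proper_subautomaton_def hda_eq_def)
  qed
  ultimately show False using hm4 unfolding HM4_def by blast
qed

text \<open>The boundary of a new cube of least degree is a shell of \<open>A\<close>. Its filler in
  \<open>A\<close> has the same faces as the new cube, so HM3 for the extension identifies the
  two.\<close>

lemma fills_HM4:
  fixes A :: "('a, 'l) hda" and T :: "('a, 'l) lts"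
  assumes A: "is_hda A" and hm1: "HM1 A T" and fills: "fills A (ltimes T)"
  shows "HM4 TYPE('x) A T"
  unfolding HM4_def
proof
  assume "\<exists>C :: ('a + 'x, 'l) hda. is_hda C \<and> HM1 C (lift_lts T) \<and> HM2 C (lift_lts T) \<and> HM3 C \<and>
           proper_subautomaton (lift_hda A) C"
  then obtain C :: "('a + 'x, 'l) hda" where C: "is_hda C" "HM1 C (lift_lts T)"
    "HM2 C (lift_lts T)" "HM3 C" and sub: "subautomaton (lift_hda A) C"
    and nsub: "\<not> subautomaton C (lift_hda A)"
    by (auto simp: proper_subautomaton_def hda_eq_def)
  have subD: "Inl x \<in> cubes C" "deg C (Inl x) = deg A x"
    "\<And>k i. i \<in> {1..deg A x} \<Longrightarrow> bd C k i (Inl x) = Inl (bd A k i x)"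
    "deg A x = 1 \<Longrightarrow> lab C (Inl x) = lab A x" if "x \<in> cubes A" for x
    using sub that by (auto simp: subautomaton_def lift_hda_def ncubes_def)
  \<comment> \<open>Properness could a priori come from labels or final states alone, but HM1 fixes
    both, so the extension has a new cube.\<close>
  have "\<exists>z. z \<in> cubes C \<and> z \<notin> Inl ` cubes A"
  proof (rule ccontr)
    assume "\<not> ?thesis"
    then have sup: "cubes C \<subseteq> Inl ` cubes A" by blast
    have "labels C = labels A" "final C = Inl ` final A"
      using C(2) hm1 by (auto simp: HM1_iff lift_lts_def lift_hda_def)
    moreover have "init C = Inl (init A)"
      using sub by (simp add: subautomaton_def lift_hda_def)
    moreover have "deg C z = deg A (projl z) \<and>
        (\<forall>k. \<forall>i \<in> {1..deg C z}. bd C k i z = Inl (bd A k i (projl z))) \<and>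
        (deg C z = 1 \<longrightarrow> lab C z = lab A (projl z))" if "z \<in> cubes C" for z
      using sup that subD(2-4) by force
    ultimately have "subautomaton C (lift_hda A)"
      using sup unfolding subautomaton_def lift_hda_def ncubes_def by simp
    then show False using nsub by simp
  qed
  then obtain z where z: "z \<in> cubes C" "z \<notin> Inl ` cubes A"
    and least: "\<And>w. w \<in> cubes C \<Longrightarrow> w \<notin> Inl ` cubes A \<Longrightarrow> deg C z \<le> deg C w"
    using ex_has_least_nat[of "\<lambda>z. z \<in> cubes C \<and> z \<notin> Inl ` cubes A" _ "deg C"] by blast
  define m where "m = deg C z"
  have zm: "z \<in> ncubes C m" using z by (simp add: m_def ncubes_def)
  \<comment> \<open>HM1 leaves no room for new vertices or edges.\<close>
  have m: "2 \<le> m"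
  proof (rule ccontr)
    assume "\<not> 2 \<le> m"
    then have "z \<in> cubes (U (lift_lts T))"
      using C(2) z(1) unfolding HM1_iff m_def by auto
    then show False using hm1 z(2) by (auto simp: HM1_iff lift_lts_def lift_hda_def)
  qed
  \<comment> \<open>\<open>projl\<close> loses nothing: the faces of \<open>z\<close> have degree
    \<open>m - 1\<close>, so by minimality they lie in the image of \<open>A\<close>.\<close>
  define f where "f k i = projl (bd C k i z)" for k i
  have f: "bd C k i z = Inl (f k i) \<and> f k i \<in> ncubes A (m - 1)" if "i \<in> {1..m}" for k i
  proof -
    have w: "bd C k i z \<in> ncubes C (m - 1)"
      using bd_ncubes[OF is_hda_precubical[OF C(1)] zm] that by auto
    then have "bd C k i z \<in> Inl ` cubes A"
      using least[of "bd C k i z"] m unfolding ncubes_def m_def by fastforce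
    then show ?thesis using w subD(2) by (auto simp: f_def ncubes_def)
  qed
  have fc: "f k i \<in> cubes A" "deg A (f k i) = m - 1" if "i \<in> {1..m}" for k i
    using f[OF that] by (auto simp: ncubes_def)
  have "shell A (ltimes T) m f"
    unfolding shell_def
  proof (intro conjI allI impI ballI)
    fix k l i j
    assume ij: "1 \<le> i \<and> i < j \<and> j \<le> m"
    have "bd C k i (bd C l j z) = bd C l (j - 1) (bd C k i z)"
      using bd_bd[OF is_hda_precubical[OF C(1)] zm] ij by auto
    moreover have "i \<in> {1..m - 1}" "j - 1 \<in> {1..m - 1}" "i \<in> {1..m}" "j \<in> {1..m}"
      using ij by auto
    ultimately show "bd A k i (f l j) = bd A l (j - 1) (f k i)"
      using f[of i k] f[of j l] subD(3)[OF fc(1), of j i l k] subD(3)[OF fc(1), of i "j - 1" k l]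
        fc(2)[of i k] fc(2)[of j l] by simp
  next
    fix i :: nat
    assume "m = 2" "i \<in> {1, 2}"
    then have "lab C (bd C 0 i z) = lab C (bd C 1 i z)" "i \<in> {1..m}"
      using C(1) zm by (auto simp: is_hda_def)
    then show "lab A (f 0 i) = lab A (f 1 i)"
      using f subD(4)[OF fc(1)] fc(2) \<open>m = 2\<close> by auto
  next
    assume "m = 2"
    then have "(lab C (bd C 0 2 z), lab C (bd C 0 1 z)) \<in> ltimes T"
      using C(3) zm by (auto simp: HM2_def lift_lts_def)
    then show "(lab A (f 0 2), lab A (f 0 1)) \<in> ltimes T"
      using f subD(4)[OF fc(1)] fc(2) \<open>m = 2\<close> by auto
  qed (use f in auto)
  then obtain x where x: "x \<in> ncubes A m" "\<forall>k. \<forall>i \<in> {1..m}. bd A k i x = f k i"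
    using fills m unfolding fills_def by blast
  have "Inl x \<in> ncubes C m" "\<forall>k. \<forall>i\<in>{1..m}. bd C k i (Inl x) = bd C k i z"
    using x subD f by (auto simp: ncubes_def)
  then have "Inl x = z"
    using C(4) zm m unfolding HM3_def by blast
  then show False using x z by (auto simp: ncubes_def)
qed

section \<open>The tensor product is an HDA and inherits HM3\<close>

lemma ncubes_tensor:
  "(x, y) \<in> ncubes (A \<otimes> B) n \<longleftrightarrow>
     x \<in> ncubes A (deg A x) \<and> y \<in> ncubes B (deg B y) \<and> deg A x + deg B y = n"
  by (auto simp: ncubes_def tensor_def)

lemma bd_tensor:
  "bd (A \<otimes> B) k i (x, y) =
     (if i \<le> deg A x then (bd A k i x, y) else (x, bd B k (i - deg A x) y))"
  by (simp add: tensor_def)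

lemma lab_tensor:
  "lab (A \<otimes> B) (x, y) = (if deg A x = 1 then Inl (lab A x) else Inr (lab B y))"
  by (simp add: tensor_def)

lemma deg_bd:
  "precubical A \<Longrightarrow> x \<in> ncubes A n \<Longrightarrow> 1 \<le> i \<Longrightarrow> i \<le> n \<Longrightarrow> deg A (bd A k i x) = n - 1"
  using bd_ncubes by (fastforce simp: ncubes_def)

lemma ncubes_deg: "x \<in> ncubes A n \<Longrightarrow> deg A x = n"
  by (simp add: ncubes_def)

lemma precubical_tensor:
  assumes A: "precubical A" and B: "precubical B"
  shows "precubical (A \<otimes> B)"
  unfolding precubical_def
proof (intro conjI allI impI ballI)
  fix n z k i
  assume "z \<in> ncubes (A \<otimes> B) n" and i: "i \<in> {1..n}"
  then obtain x y p q where z: "z = (x, y)" "x \<in> ncubes A p" "y \<in> ncubes B q" "p + q = n"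
    by (cases z) (auto simp: ncubes_tensor)
  show "bd (A \<otimes> B) k i z \<in> ncubes (A \<otimes> B) (n - 1)"
  proof (cases "i \<le> p")
    case True
    then show ?thesis
      using z i bd_ncubes[OF A z(2), of i k] by (auto simp: bd_tensor ncubes_tensor ncubes_deg)
  next
    case False
    then have "1 \<le> i - p" "i - p \<le> q" using i z(4) by auto
    then show ?thesis
      using False z i bd_ncubes[OF B z(3), of "i - p" k]
      by (auto simp: bd_tensor ncubes_tensor ncubes_deg)
  qed
next
  fix n z k l i j
  assume "z \<in> ncubes (A \<otimes> B) n" and ij: "1 \<le> i \<and> i < j \<and> j \<le> n"
  then obtain x y p q where z: "z = (x, y)" "x \<in> ncubes A p" "y \<in> ncubes B q" "p + q = n"
    by (cases z) (auto simp: ncubes_tensor)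
  consider "j \<le> p" | "i \<le> p" "p < j" | "p < i" by linarith
  then show "bd (A \<otimes> B) k i (bd (A \<otimes> B) l j z) = bd (A \<otimes> B) l (j - 1) (bd (A \<otimes> B) k i z)"
  proof cases
    case 1
    then show ?thesis
      using z ij bd_bd[OF A z(2), of i j k l] deg_bd[OF A z(2)]
      by (auto simp: bd_tensor ncubes_deg)
  next
    case 2
    \<comment> \<open>A face in the first factor lowers its degree to \<open>p - 1\<close>, so
      direction \<open>j - 1\<close> of the resulting pair is still direction \<open>j - p\<close>
      of \<open>y\<close>.\<close>
    then have "j - Suc 0 - (p - Suc 0) = j - p" using ij by linarith
    then show ?thesis
      using 2 z ij deg_bd[OF A z(2)] by (auto simp: bd_tensor ncubes_deg)
  next
    case 3
    then show ?thesis
      using z ij bd_bd[OF B z(3), of "i - p" "j - p" k l]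
      by (auto simp: bd_tensor ncubes_deg)
  qed
qed

lemma is_hda_tensor:
  assumes A: "is_hda A" and B: "is_hda B"
  shows "is_hda (A \<otimes> B)"
  unfolding is_hda_def
proof (intro conjI ballI)
  note pA = is_hda_precubical[OF A] and pB = is_hda_precubical[OF B]
  show "precubical (A \<otimes> B)" using precubical_tensor pA pB .
  show "init (A \<otimes> B) \<in> ncubes (A \<otimes> B) 0" "final (A \<otimes> B) \<subseteq> ncubes (A \<otimes> B) 0"
    using A B by (auto simp: is_hda_def tensor_def ncubes_def)
  show "lab (A \<otimes> B) z \<in> labels (A \<otimes> B)" if "z \<in> ncubes (A \<otimes> B) 1" for z
    using A B that by (auto simp: is_hda_def tensor_def ncubes_def)
  fix z i
  assume "z \<in> ncubes (A \<otimes> B) 2" and i: "i \<in> {1, 2 :: nat}"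
  then obtain x y p q where z: "z = (x, y)" "x \<in> ncubes A p" "y \<in> ncubes B q" "p + q = 2"
    by (cases z) (auto simp: ncubes_tensor)
  consider "p = 2" "q = 0" | "p = 1" "q = 1" | "p = 0" "q = 2" using z by linarith
  then show "lab (A \<otimes> B) (bd (A \<otimes> B) 0 i z) = lab (A \<otimes> B) (bd (A \<otimes> B) 1 i z)"
  proof cases
    case 1
    then show ?thesis using z i A deg_bd[OF pA z(2)]
      by (auto simp: bd_tensor lab_tensor ncubes_deg is_hda_def)
  next
    \<comment> \<open>In bidegree (1, 1) opposite edges share their edge component, hence their
      label.\<close>
    case 2
    then show ?thesis using z i deg_bd[OF pA z(2)]
      by (auto simp: bd_tensor lab_tensor ncubes_deg)
  next
    case 3
    then show ?thesis using z i B
      by (auto simp: bd_tensor lab_tensor ncubes_deg is_hda_def)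
  qed
qed

text \<open>The degrees of the faces reveal the bidegree \<open>(p, q)\<close>. If
  \<open>q >= 1\<close>, faces in the last direction contain \<open>x\<close> itself; if
  \<open>p >= 1\<close>, faces in the first direction contain \<open>y\<close>. A component left
  undetermined has the full degree \<open>m\<close>, and HM3 of its factor applies.\<close>

lemma HM3_tensor:
  assumes A: "precubical A" and B: "precubical B" and "HM3 A" "HM3 B"
  shows "HM3 (A \<otimes> B)"
  unfolding HM3_def
proof (intro allI impI ballI)
  fix m z w
  assume m: "2 \<le> m" and "z \<in> ncubes (A \<otimes> B) m" "w \<in> ncubes (A \<otimes> B) m"
    and eq: "\<forall>k. \<forall>r\<in>{1..m}. bd (A \<otimes> B) k r z = bd (A \<otimes> B) k r w"
  then obtain x y p q x' y' p' q'
    where z: "z = (x, y)" "x \<in> ncubes A p" "y \<in> ncubes B q" "p + q = m"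
      and w: "w = (x', y')" "x' \<in> ncubes A p'" "y' \<in> ncubes B q'" "p' + q' = m"
    by (cases z; cases w) (auto simp: ncubes_tensor)
  have feq: "(if r \<le> p then (bd A k r x, y) else (x, bd B k (r - p) y)) =
     (if r \<le> p' then (bd A k r x', y') else (x', bd B k (r - p') y'))" if "1 \<le> r" "r \<le> m" for k r
  proof -
    have "bd (A \<otimes> B) k r (x, y) = bd (A \<otimes> B) k r (x', y')"
      using eq that z(1) w(1) by simp
    then show ?thesis
      unfolding bd_tensor ncubes_deg[OF z(2)] ncubes_deg[OF w(2)] .
  qed
  have deg: "(if r \<le> p then p - 1 else p) = (if r \<le> p' then p' - 1 else p')"
    if "1 \<le> r" "r \<le> m" for r
    using feq[OF that, of 0] that z w deg_bd[OF A z(2), of r 0] deg_bd[OF A w(2), of r 0]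
      ncubes_deg[OF z(2)] ncubes_deg[OF w(2)]
    by (auto split: if_splits)
  \<comment> \<open>In directions 1 and \<open>m\<close> the first components have degrees
    \<open>(0, 0)\<close>, \<open>(m - 1, m - 1)\<close> or \<open>(p - 1, p)\<close>, according to
    whether \<open>p = 0\<close>, \<open>p = m\<close> or neither; \<open>2 <= m\<close> keeps these
    apart.\<close>
  have pp: "p' = p"
    using deg[of 1] deg[of m] m z w by (auto split: if_splits)
  then have qq: "q' = q" using z w by simp
  have yy: "y = y'" if "1 \<le> p"
    using feq[of 1] that pp m by auto
  have xx: "x = x'" if "1 \<le> q"
    using feq[of m] that pp m z by auto
  have fx: "\<forall>k. \<forall>r\<in>{1..p}. bd A k r x = bd A k r x'"
  proof (intro allI ballI)
    fix k r
    assume "r \<in> {1..p}"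
    then show "bd A k r x = bd A k r x'"
      using feq[of r k] z(4) pp by auto
  qed
  have fy: "bd B k r y = bd B k r y'" if "r \<in> {1..q}" for k r
    using feq[of "p + r" k] that z pp by auto
  consider "1 \<le> p" "1 \<le> q" | "p = 0" "2 \<le> q" | "q = 0" "2 \<le> p"
    using m z by linarith
  then show "z = w"
  proof cases
    case 1
    then show ?thesis using xx yy z w by simp
  next
    case 2
    then have "y = y'" using \<open>HM3 B\<close> fy z w qq unfolding HM3_def by blast
    then show ?thesis using 2 xx z w by simp
  next
    case 3
    then have "x = x'" using \<open>HM3 A\<close> fx z w pp unfolding HM3_def by blast
    then show ?thesis using 3 yy z w by simp
  qed
qed

section \<open>Bidegrees of the faces of a shell\<close>

text \<open>\<open>a k i\<close> is the degree of the first component of a face, and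
  \<open>rel\<close> is the trace of the incidence relations on these degrees. In dimension 2,
  degree 1 in direction 1 and degree 0 in direction 2 would satisfy \<open>rel\<close> without
  having the stated form; only labels can rule that out.\<close>

lemma face_degrees:
  fixes a :: "bit \<Rightarrow> nat \<Rightarrow> nat"
  assumes m: "3 \<le> m" and le: "\<And>k i. 1 \<le> i \<Longrightarrow> i \<le> m \<Longrightarrow> a k i \<le> m - 1"
    and rel: "\<And>k l i j. 1 \<le> i \<Longrightarrow> i < j \<Longrightarrow> j \<le> m \<Longrightarrow>
       (if i \<le> a l j then a l j - 1 else a l j) = (if j - 1 \<le> a k i then a k i - 1 else a k i)"
  shows "\<exists>p \<le> m. \<forall>k. \<forall>i \<in> {1..m}. a k i = (if i \<le> p then p - 1 else p)"
proof -
  \<comment> \<open>If \<open>p = 0\<close>, all faces have degree 0; otherwise the first face has degree \<open>p - 1\<close>.\<close>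
  define p where "p = (if a 0 m = 0 then 0 else a 0 1 + 1)"
  have le1: "a k 1 \<le> m - 1" and lem: "a k m \<le> m - 1" for k
    using le m by auto
  have r1m: "(if 1 \<le> a l m then a l m - 1 else a l m) = (if m - 1 \<le> a k 1 then a k 1 - 1 else a k 1)" for k l
    using rel[of 1 m l k] m by auto
  have ends: "p \<le> m" "a 0 1 = (if 1 \<le> p then p - 1 else p)" "a 0 m = (if m \<le> p then p - 1 else p)"
    using r1m[of 0 0] le1[of 0] lem[of 0] m unfolding p_def by (simp split: if_splits; linarith)+
  consider "p = 0" "a 0 1 = 0" "a 0 m = 0" | "p = m" "a 0 1 = m - 1" "a 0 m = m - 1"
    | "1 \<le> p" "p < m" "a 0 1 = p - 1" "a 0 m = p"
    using ends m by (cases "p = 0"; cases "p = m") auto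
  note p_cases = this
  \<comment> \<open>An interior direction is compared with both ends, where the degrees of the
    0-faces are already known.\<close>
  have mid: "a k i = (if i \<le> p then p - 1 else p)" if i: "1 < i" "i < m" for k i
  proof -
    have r: "(if 1 \<le> a k i then a k i - 1 else a k i) =
        (if i - 1 \<le> a 0 1 then a 0 1 - 1 else a 0 1)"
      "(if i \<le> a 0 m then a 0 m - 1 else a 0 m) = (if m - 1 \<le> a k i then a k i - 1 else a k i)"
      using rel[of 1 i k 0] rel[of i m 0 k] i by auto
    have "a k i \<le> m - 1" using le i by auto
    from p_cases show ?thesis
    proof cases
      case 1
      then show ?thesis using r m by (simp split: if_splits)
    next
      case 2
      then have "a k i - 1 = m - 2" using r(1) i m by (simp split: if_splits)
      then show ?thesis using 2 m i \<open>a k i \<le> m - 1\<close> by simp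
    next
      case 3
      show ?thesis
      \<comment> \<open>Subtraction is truncated, so the equation from direction 1 may fail to tell
        degrees 0 and 1 apart; the equation from direction \<open>m\<close> then decides.\<close>
      proof (cases "i \<le> p")
        case True
        then have "a k i - 1 = p - 2" "(if m - 1 \<le> a k i then a k i - 1 else a k i) = p - 1"
          using r 3 i by (simp_all split: if_splits)
        then show ?thesis using True i m by (simp split: if_splits)
      next
        case False
        then have "a k i - 1 = p - 1" "(if m - 1 \<le> a k i then a k i - 1 else a k i) = p"
          using r 3 i by (simp_all split: if_splits)
        then show ?thesis using False 3 by (simp split: if_splits)
      qed
    qed
  qed
  \<comment> \<open>Direction 2 is interior because \<open>3 <= m\<close>, so its degrees are known;
    it carries the claim from the 0-faces to all faces at both ends.\<close>
  have "a k 1 = (if 1 \<le> p then p - 1 else p)" for k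
  proof -
    have r: "(if 1 \<le> a 0 2 then a 0 2 - 1 else a 0 2) = (if 1 \<le> a k 1 then a k 1 - 1 else a k 1)"
      using rel[of 1 2 0 k] m by auto
    have d: "a 0 2 = (if 2 \<le> p then p - 1 else p)" using mid[of 2 0] m by simp
    from p_cases show ?thesis
    proof cases
      case 1
      then show ?thesis using d r r1m[of 0 k] m by (simp split: if_splits)
    next
      case 2
      then show ?thesis using d r le1[of k] m by (simp split: if_splits)
    next
      case 3
      then show ?thesis using d r r1m[of 0 k] m by (simp split: if_splits)
    qed
  qed
  moreover have "a k m = (if m \<le> p then p - 1 else p)" for k
  proof -
    have r: "(if 2 \<le> a k m then a k m - 1 else a k m) = (if m - 1 \<le> a 0 2 then a 0 2 - 1 else a 0 2)"
      using rel[of 2 m k 0] m by auto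
    have d: "a 0 2 = (if 2 \<le> p then p - 1 else p)" using mid[of 2 0] m by simp
    from p_cases show ?thesis
    proof cases
      case 1
      then show ?thesis using d r r1m[of k 0] m by (simp split: if_splits)
    next
      case 2
      then show ?thesis using d r r1m[of k 0] lem[of k] m by (simp split: if_splits)
    next
      case 3
      then show ?thesis using d r r1m[of k 0] m by (simp split: if_splits)
    qed
  qed
  ultimately have "a k i = (if i \<le> p then p - 1 else p)" if "i \<in> {1..m}" for k i
    using mid[of i k] that by (cases "i = 1 \<or> i = m") auto
  then show ?thesis using ends by blast
qed
text \<open>For \<open>m = 2\<close> the one bad pattern is a square with its two directions
  swapped. Its pair of labels would have the form \<open>(Inr _, Inl _)\<close>, which
  \<open>P\<close> excludes.\<close>

lemma tensor_shell_degrees: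
  assumes A: "precubical A" and B: "precubical B"
    and P: "\<And>\<alpha> \<beta>. (Inr \<beta>, Inl \<alpha>) \<notin> P"
    and m: "2 \<le> m" and f: "shell (A \<otimes> B) P m f"
  shows "\<exists>p \<le> m. \<forall>k. \<forall>i \<in> {1..m}. deg A (fst (f k i)) = (if i \<le> p then p - 1 else p)"
proof -
  define a where "a k i = deg A (fst (f k i))" for k i
  have fc: "fst (f k i) \<in> ncubes A (a k i)" "snd (f k i) \<in> ncubes B (deg B (snd (f k i)))"
    "a k i + deg B (snd (f k i)) = m - 1" if "1 \<le> i" "i \<le> m" for k i
    using f that ncubes_tensor[of "fst (f k i)" "snd (f k i)" A B "m - 1"]
    unfolding shell_def a_def by auto
  have le: "a k i \<le> m - 1" if "1 \<le> i" "i \<le> m" for k i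
    using fc(3)[OF that, of k] by simp
  have deg_fst: "deg A (fst (bd (A \<otimes> B) k i (f l j))) =
      (if i \<le> a l j then a l j - 1 else a l j)" if "1 \<le> i" "1 \<le> j" "j \<le> m" for k l i j
    using bd_tensor[of A B k i "fst (f l j)" "snd (f l j)"] deg_bd[OF A fc(1)] that
    by (auto simp: a_def)
  have rel: "(if i \<le> a l j then a l j - 1 else a l j) = (if j - 1 \<le> a k i then a k i - 1 else a k i)"
    if "1 \<le> i" "i < j" "j \<le> m" for k l i j
  proof -
    have "bd (A \<otimes> B) k i (f l j) = bd (A \<otimes> B) l (j - 1) (f k i)"
      using f that unfolding shell_def by blast
    then show ?thesis
      using deg_fst[of i j k l] deg_fst[of "j - 1" i l k] that by auto
  qed
  show ?thesis
  proof (cases "m = 2")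
    case False
    then show ?thesis
      using face_degrees[of m a] le rel m unfolding a_def by simp
  next
    case True
    have lab: "lab (A \<otimes> B) (f k i) = (if a k i = 1 then Inl (lab A (fst (f k i))) else Inr (lab B (snd (f k i))))"
      for k i
      using lab_tensor[of A B "fst (f k i)" "snd (f k i)"] by (simp add: a_def)
    \<comment> \<open>Opposite faces have equal labels, hence labels in the same summand, and the
      summand tells which component is the edge.\<close>
    have a01: "a 1 i = a 0 i" "a 0 i = 0 \<or> a 0 i = 1" if "i \<in> {1, 2}" for i
    proof -
      have i: "1 \<le> i" "i \<le> m" using that True by auto
      have "lab (A \<otimes> B) (f 0 i) = lab (A \<otimes> B) (f 1 i)"
        using f True that unfolding shell_def by blast
      then show "a 1 i = a 0 i" "a 0 i = 0 \<or> a 0 i = 1"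
        using le[OF i, of 0] le[OF i, of 1] True unfolding lab by (auto split: if_splits)
    qed
    have "(lab (A \<otimes> B) (f 0 2), lab (A \<otimes> B) (f 0 1)) \<in> P"
      using f True unfolding shell_def by blast
    then have "\<not> (a 0 1 = 1 \<and> a 0 2 = 0)"
      unfolding lab using P by force
    \<comment> \<open>The three remaining patterns (0, 0), (0, 1) and (1, 1) belong to
      \<open>p\<close> = 0, 1 and 2, so the witness is their sum.\<close>
    then obtain p where p: "p \<le> 2" "a 0 1 = (if 1 \<le> p then p - 1 else p)"
      "a 0 2 = (if 2 \<le> p then p - 1 else p)"
      using a01(2)[of 1] a01(2)[of 2] that[of "a 0 1 + a 0 2"] by auto
    have "a k i = (if i \<le> p then p - 1 else p)" if "i \<in> {1..m}" for k i
    proof -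
      have "i = 1 \<or> i = 2" using that True by auto
      moreover have "a k i = a 0 i"
        using a01(1)[of i] calculation by (cases k) auto
      ultimately show ?thesis using p by auto
    qed
    then show ?thesis using p(1) True unfolding a_def by blast
  qed
qed

section \<open>Filling shells of the tensor product\<close>

text \<open>The first condition on \<open>P\<close> fixes the order of the directions of a square
  shell; the other two pass its label condition to the factor in which it has to be filled.\<close>

lemma fills_tensor:
  assumes A: "precubical A" "HM3 A" "edges_determined A" "fills A R"
    and B: "precubical B" "HM3 B" "edges_determined B" "fills B Q"
    and P: "\<And>\<alpha> \<beta>. (Inr \<beta>, Inl \<alpha>) \<notin> P" "\<And>\<alpha> \<alpha>'. (Inl \<alpha>, Inl \<alpha>') \<in> P \<Longrightarrow> (\<alpha>, \<alpha>') \<in> R"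
      "\<And>\<beta> \<beta>'. (Inr \<beta>, Inr \<beta>') \<in> P \<Longrightarrow> (\<beta>, \<beta>') \<in> Q"
  shows "fills (A \<otimes> B) P"
  unfolding fills_def
proof (intro allI impI)
  fix m f
  assume m: "2 \<le> m" and f: "shell (A \<otimes> B) P m f"
  define x y where "x k i = fst (f k i)" and "y k i = snd (f k i)" for k i
  have fxy: "f k i = (x k i, y k i)" for k i by (simp add: x_def y_def)
  obtain p where p: "p \<le> m"
    and dx: "\<And>k i. 1 \<le> i \<Longrightarrow> i \<le> m \<Longrightarrow> deg A (x k i) = (if i \<le> p then p - 1 else p)"
    using tensor_shell_degrees[OF A(1) B(1) P(1) m f] unfolding x_def by auto
  define q where "q = m - p"
  have pq: "p + q = m" using p by (simp add: q_def)
  have fc: "x k i \<in> ncubes A (if i \<le> p then p - 1 else p) \<and>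
      y k i \<in> ncubes B (if i \<le> p then q else q - 1)" if i: "1 \<le> i" "i \<le> m" for k i
  proof -
    have "(x k i, y k i) \<in> ncubes (A \<otimes> B) (m - 1)"
      using f that unfolding shell_def fxy by auto
    then have "x k i \<in> ncubes A (deg A (x k i))" "y k i \<in> ncubes B (deg B (y k i))"
      "deg A (x k i) + deg B (y k i) = m - 1"
      by (simp_all add: ncubes_tensor)
    moreover have "deg B (y k i) = (if i \<le> p then q else q - 1)"
      using calculation(3) dx[OF i] pq i by (auto split: if_splits)
    ultimately show ?thesis using dx[OF i] by simp
  qed
  have rel: "(if i \<le> deg A (x l j) then (bd A k i (x l j), y l j)
        else (x l j, bd B k (i - deg A (x l j)) (y l j))) =
      (if j - 1 \<le> deg A (x k i) then (bd A l (j - 1) (x k i), y k i)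
        else (x k i, bd B l (j - 1 - deg A (x k i)) (y k i)))"
    if "1 \<le> i" "i < j" "j \<le> m" for k l i j
  proof -
    have "bd (A \<otimes> B) k i (f l j) = bd (A \<otimes> B) l (j - 1) (f k i)"
      using f that unfolding shell_def by blast
    then show ?thesis unfolding fxy bd_tensor .
  qed
  \<comment> \<open>The incidence relations split according to whether \<open>i < j\<close> both lie
    among the first \<open>p\<close> directions, on either side of \<open>p\<close>, or both beyond
    it.\<close>
  have rel_left: "bd A k i (x l j) = bd A l (j - 1) (x k i)" "y l j = y k i"
    if "1 \<le> i" "i < j" "j \<le> p" for k l i j
  proof -
    have "i \<le> p - 1" "j - 1 \<le> p - 1" using that by auto
    then show "bd A k i (x l j) = bd A l (j - 1) (x k i)" "y l j = y k i"
      using rel[of i j l k] that p dx[of i k] dx[of j l] by auto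
  qed
  \<comment> \<open>The face \<open>x k i\<close> does not depend on \<open>l\<close> and
    \<open>j\<close>: the first components in the last \<open>q\<close> directions share one
    boundary, and dually for the second components.\<close>
  have rel_mixed: "bd A k i (x l j) = x k i" "bd B l (j - p) (y k i) = y l j"
    if "1 \<le> i" "i \<le> p" "p < j" "j \<le> m" for k l i j
  proof -
    have "j - 1 - (p - 1) = j - p" "\<not> j - 1 \<le> p - 1" "\<not> j \<le> p" "1 \<le> j" "i \<le> m"
      using that p by auto
    moreover have "deg A (x k i) = p - 1" "deg A (x l j) = p"
      using dx[of i k] dx[of j l] calculation that by auto
    ultimately show "bd A k i (x l j) = x k i" "bd B l (j - p) (y k i) = y l j"
      using rel[of i j l k] that by simp_all
  qed
  have rel_right: "x l j = x k i"
      "bd B k (i - p) (y l j) = bd B l (j - 1 - p) (y k i)"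
    if "1 \<le> i" "p < i" "i < j" "j \<le> m" for k l i j
  proof -
    have "\<not> i \<le> p" "\<not> j - 1 \<le> p" "\<not> j \<le> p" "1 \<le> j" "i \<le> m"
      using that p by auto
    moreover have "deg A (x k i) = p" "deg A (x l j) = p"
      using dx[of i k] dx[of j l] calculation that by auto
    ultimately show "x l j = x k i"
      "bd B k (i - p) (y l j) = bd B l (j - 1 - p) (y k i)"
      using rel[of i j l k] that by simp_all
  qed
  have shell_lab: "lab (A \<otimes> B) (x 0 i, y 0 i) = lab (A \<otimes> B) (x 1 i, y 1 i)"
    "(lab (A \<otimes> B) (x 0 2, y 0 2), lab (A \<otimes> B) (x 0 1, y 0 1)) \<in> P"
    if "m = 2" "i \<in> {1, 2}" for i
    using f that unfolding shell_def fxy by blast+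
  \<comment> \<open>Incidences compare distinct directions only, so the two faces in direction 1 are
    linked through direction 2, hence \<open>2 <= p\<close>. Likewise direction \<open>m\<close>
    goes through \<open>m - 1\<close> in \<open>x_const\<close>.\<close>
  have y_const: "y k i = y 0 1" if "2 \<le> p" "1 \<le> i" "i \<le> p" for k i
    using rel_left(2)[of 1 i k 0] rel_left(2)[of 1 2 0 k] rel_left(2)[of 1 2 0 0] that
    by (cases "i = 1") simp_all
  have x_const: "x l j = x 0 m" if "2 \<le> q" "p < j" "j \<le> m" for l j
    using rel_right(1)[of j m 0 l] rel_right(1)[of "m - 1" m l 0] rel_right(1)[of "m - 1" m 0 0] that pq
    by (cases "j = m") simp_all
  have "\<exists>u v. u \<in> ncubes A p \<and> v \<in> ncubes B q \<and>
      (\<forall>k. \<forall>i \<in> {1..m}. (if i \<le> p then (bd A k i u, v) else (u, bd B k (i - p) v)) = (x k i, y k i))"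
  proof -
    consider "q = 0" | "p = 0" | "1 \<le> p" "1 \<le> q" by linarith
    then show ?thesis
    proof cases
      case 1
      then have pm: "p = m" using pq by simp
      \<comment> \<open>All directions belong to \<open>A\<close>: the first components form a shell
        there, and the second components are one fixed vertex.\<close>
      have "shell A R m x"
        unfolding shell_def
      proof (intro conjI allI impI ballI)
        fix i :: nat assume "m = 2" and i: "i \<in> {1, 2}"
        then show "lab A (x 0 i) = lab A (x 1 i)"
          using shell_lab(1)[of i] dx[of i] pm unfolding lab_tensor by auto
      next
        assume "m = 2"
        then show "(lab A (x 0 2), lab A (x 0 1)) \<in> R"
          using shell_lab(2)[of 1] dx[of 1] dx[of 2] pm P(2) unfolding lab_tensor by auto
      qed (use fc rel_left pm in auto)
      then obtain u where "u \<in> ncubes A m" "\<forall>k. \<forall>i \<in> {1..m}. bd A k i u = x k i"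
        using A(4) m unfolding fills_def by blast
      moreover obtain v where v: "y 0 1 = v" by simp
      have "v \<in> ncubes B q" using fc[of 1 0] pm m v by auto
      moreover have "y k i = v" if "i \<in> {1..m}" for k i
        using y_const[of i k] that pm m v by simp
      ultimately show ?thesis
        using pm by (intro exI[of _ u] exI[of _ v]) simp
    next
      case 2
      then have qm: "q = m" using pq by simp
      have "shell B Q m y"
        unfolding shell_def
      proof (intro conjI allI impI ballI)
        fix i :: nat assume "m = 2" and i: "i \<in> {1, 2}"
        then show "lab B (y 0 i) = lab B (y 1 i)"
          using shell_lab(1)[of i] dx[of i] \<open>p = 0\<close> unfolding lab_tensor by auto
      next
        assume "m = 2"
        then show "(lab B (y 0 2), lab B (y 0 1)) \<in> Q"
          using shell_lab(2)[of 1] dx[of 1] dx[of 2] \<open>p = 0\<close> P(3) unfolding lab_tensor by auto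
      next
        fix k l i j assume "1 \<le> i \<and> i < j \<and> j \<le> m"
        then show "bd B k i (y l j) = bd B l (j - 1) (y k i)"
          using rel_right(2)[of i j k l] \<open>p = 0\<close> by simp
      qed (use fc[of _ _] qm \<open>p = 0\<close> in auto)
      then obtain v where "v \<in> ncubes B m" "\<forall>k. \<forall>i \<in> {1..m}. bd B k i v = y k i"
        using B(4) m unfolding fills_def by blast
      moreover obtain u where u: "x 0 m = u" by simp
      have "u \<in> ncubes A p" using fc[of m 0] \<open>p = 0\<close> m u by auto
      moreover have "x k i = u" if "i \<in> {1..m}" for k i
        using x_const[of i k] that qm m \<open>p = 0\<close> u by simp
      ultimately show ?thesis
        using \<open>p = 0\<close> qm by (intro exI[of _ u] exI[of _ v]) simp
    next
      case 3
      have pm: "1 \<le> m" "p < m" "p \<le> m" using 3 pq by auto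
      have u: "x l j = x 0 m" if j: "p < j" "j \<le> m" for l j
      proof -
        \<comment> \<open>For \<open>q >= 2\<close> incidence suffices. Otherwise only the two faces
          in direction \<open>m\<close> are compared; they have the same boundary, so HM3 applies if
          \<open>p >= 2\<close>, and the equal labels of opposite edges settle
          \<open>p = 1\<close>.\<close>
        consider "2 \<le> q" | "2 \<le> p" | "p = 1" "q = 1" using 3 by linarith
        then show ?thesis
        proof cases
          case 1
          then show ?thesis using x_const j by blast
        next
          case 2
          have "x l j \<in> ncubes A p" "x 0 m \<in> ncubes A p"
            using fc[of j l] fc[of m 0] j pm by auto
          moreover have "\<forall>k. \<forall>r \<in> {1..p}. bd A k r (x l j) = bd A k r (x 0 m)"
            using rel_mixed(1) j pm by auto
          ultimately show ?thesis using A(2) 2 unfolding HM3_def by blast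
        next
          case 3
          then have m2: "m = 2" "j = 2" using pq j by auto
          have "x l 2 \<in> ncubes A 1" for l
            using fc[of 2 l] 3 m2 by auto
          moreover have "bd A k 1 (x l 2) = bd A k 1 (x 0 2)" for k l
            using rel_mixed(1)[of 1 2] 3 m2 by simp
          moreover have "lab A (x 0 2) = lab A (x 1 2)"
            using shell_lab(1)[of 2] m2 3 dx[of 2] unfolding lab_tensor by auto
          then have "lab A (x l 2) = lab A (x 0 2)" for l
            by (cases l) auto
          ultimately show ?thesis using A(3) m2 unfolding edges_determined_def by blast
        qed
      qed
      have v: "y k i = y 0 1" if i: "1 \<le> i" "i \<le> p" for k i
      proof -
        consider "2 \<le> p" | "2 \<le> q" | "p = 1" "q = 1" using 3 by linarith
        then show ?thesis
        proof cases
          case 1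
          then show ?thesis using y_const i by blast
        next
          case 2
          have "y k i \<in> ncubes B q" "y 0 1 \<in> ncubes B q"
            using fc[of i k] fc[of 1 0] i pm by auto
          moreover have "bd B l r (y k i) = bd B l r (y 0 1)" if "r \<in> {1..q}" for l r
            using rel_mixed(2)[of _ "p + r"] that i pq by auto
          ultimately show ?thesis using B(2) 2 unfolding HM3_def by blast
        next
          case 3
          then have m2: "m = 2" "i = 1" using pq i by auto
          have "y k 1 \<in> ncubes B 1" for k
            using fc[of 1 k] 3 m2 by auto
          moreover have "bd B l 1 (y k 1) = bd B l 1 (y 0 1)" for k l
            using rel_mixed(2)[of 1 2] 3 m2 by simp
          moreover have "lab B (y 0 1) = lab B (y 1 1)"
            using shell_lab(1)[of 1] m2 3 dx[of 1] unfolding lab_tensor by auto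
          then have "lab B (y k 1) = lab B (y 0 1)" for k
            by (cases k) auto
          ultimately show ?thesis using B(3) m2 unfolding edges_determined_def by blast
        qed
      qed
      \<comment> \<open>The two constant components, read off in the last and the first direction,
        form the filler.\<close>
      have "x 0 m \<in> ncubes A p" "y 0 1 \<in> ncubes B q"
        using fc[of m 0] fc[of 1 0] 3 pm by auto
      moreover have "(if i \<le> p then (bd A k i (x 0 m), y 0 1) else (x 0 m, bd B k (i - p) (y 0 1)))
          = (x k i, y k i)" if "i \<in> {1..m}" for k i
        using that u[of i k] v[of i k] rel_mixed(1)[of i m k 0] rel_mixed(2)[of 1 i k 0] pm 3
        by (cases "i \<le> p") simp_all
      ultimately show ?thesis by blast
    qed
  qed
  then obtain u v where uv: "u \<in> ncubes A p" "v \<in> ncubes B q"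
    "\<forall>k. \<forall>i \<in> {1..m}. (if i \<le> p then (bd A k i u, v) else (u, bd B k (i - p) v)) = (x k i, y k i)"
    by blast
  then have "(u, v) \<in> ncubes (A \<otimes> B) m"
    using pq by (simp add: ncubes_tensor ncubes_deg)
  moreover have "bd (A \<otimes> B) k i (u, v) = f k i" if "i \<in> {1..m}" for k i
    using uv(3) that unfolding bd_tensor fxy ncubes_deg[OF uv(1)] by blast
  ultimately show "\<exists>z \<in> ncubes (A \<otimes> B) m. \<forall>k. \<forall>i \<in> {1..m}. bd (A \<otimes> B) k i z = f k i"
    by blast
qed

section \<open>The interleaving, HM1 and HM2\<close>

lemma ncubes_trunc: "ncubes (trunc n A) k = (if k \<le> n then ncubes A k else {})"
  by (auto simp: ncubes_def trunc_def)

lemma trunc_sel [simp]: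
  "deg (trunc n A) = deg A" "bd (trunc n A) = bd A" "init (trunc n A) = init A"
  "final (trunc n A) = final A" "labels (trunc n A) = labels A" "lab (trunc n A) = lab A"
  by (simp_all add: trunc_def)

lemma is_hda_trunc:
  assumes "is_hda A"
  shows "is_hda (trunc n A)"
proof -
  have "precubical (trunc n A)"
    using is_hda_precubical[OF assms] unfolding precubical_def by (simp add: ncubes_trunc)
  then show ?thesis
    using assms unfolding is_hda_def by (auto simp: ncubes_trunc)
qed

text \<open>The summand of the common label tells which component is the edge; the other component
  is a vertex that appears unchanged in both endpoints.\<close>

lemma edges_determined_tensor:
  assumes A: "edges_determined A" and B: "edges_determined B"
  shows "edges_determined (A \<otimes> B)"
  unfolding edges_determined_def
proof (intro ballI impI)
  fix z w
  assume z: "z \<in> ncubes (A \<otimes> B) 1" and w: "w \<in> ncubes (A \<otimes> B) 1"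
    and eq: "bd (A \<otimes> B) 0 1 z = bd (A \<otimes> B) 0 1 w \<and>
      bd (A \<otimes> B) 1 1 z = bd (A \<otimes> B) 1 1 w \<and> lab (A \<otimes> B) z = lab (A \<otimes> B) w"
  obtain x y x' y' where zw: "z = (x, y)" "w = (x', y')" by (cases z; cases w)
  have mem: "x \<in> ncubes A (deg A x)" "y \<in> ncubes B (deg B y)" "deg A x + deg B y = 1"
    "x' \<in> ncubes A (deg A x')" "y' \<in> ncubes B (deg B y')" "deg A x' + deg B y' = 1"
    using z w unfolding zw ncubes_tensor by auto
  have "deg A x = 1 \<longleftrightarrow> deg A x' = 1"
    using eq unfolding zw lab_tensor by (auto split: if_splits)
  then consider "deg A x = 1" "deg A x' = 1" "deg B y = 0" "deg B y' = 0"
    | "deg A x = 0" "deg A x' = 0" "deg B y = 1" "deg B y' = 1"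
    using mem by fastforce
  then show "z = w"
  proof cases
    case 1
    then show ?thesis
      using A mem eq unfolding edges_determined_def zw bd_tensor lab_tensor by auto
  next
    case 2
    then show ?thesis
      using B mem eq unfolding edges_determined_def zw bd_tensor lab_tensor by auto
  qed
qed

lemma transition_system_edges_determined: "transition_system A \<Longrightarrow> edges_determined A"
  by (simp add: transition_system_def edges_determined_def)

lemma ltimes_transition_system_interleaving:
  assumes S: "ltimes_transition_system S" and T: "ltimes_transition_system T"
  shows "ltimes_transition_system (S ||| T)"
proof -
  have hda: "is_hda (U S)" "is_hda (U T)" and ed: "edges_determined (U S)" "edges_determined (U T)"
    using S T transition_system_edges_determined
    by (auto simp: ltimes_transition_system_def transition_system_def)
  have "transition_system (trunc 1 (U S \<otimes> U T))"
    using is_hda_trunc[OF is_hda_tensor[OF hda]] edges_determined_tensor[OF ed]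
    unfolding transition_system_def edges_determined_def
    by (simp add: ncubes_trunc) (simp add: trunc_def)
  moreover have "labels (U S \<otimes> U T) = labels (U S) <+> labels (U T)"
    by (simp add: tensor_def)
  ultimately show ?thesis
    using S T unfolding ltimes_transition_system_def interleaving_def by auto
qed

text \<open>\<open>HM1_iff\<close> starts from cubes of \<open>U T\<close>; this form starts from
  cubes of \<open>A\<close>, as the components of a pair require.\<close>

lemma HM1_cube:
  assumes "HM1 A T" and x: "x \<in> cubes A" "deg A x \<le> 1"
  shows "x \<in> cubes (U T) \<and> deg (U T) x = deg A x \<and>
      (\<forall>k. \<forall>i \<in> {1..deg A x}. bd A k i x = bd (U T) k i x) \<and>
      (deg A x = 1 \<longrightarrow> lab A x = lab (U T) x)"
proof -
  note hm1 = assms(1)[unfolded HM1_iff]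
  have "x \<in> cubes (U T)" using hm1 x by blast
  moreover from this have "deg A x = deg (U T) x" using hm1 by blast
  moreover from calculation have "x \<in> ncubes (U T) 1" if "deg A x = 1"
    using that by (simp add: ncubes_def)
  ultimately show ?thesis using hm1 by metis
qed

text \<open>A pair of total degree at most 1 has components of degree at most 1, so truncating the
  factors first does not change the truncated product.\<close>

lemma HM1_tensor:
  assumes A: "HM1 A S" and B: "HM1 B T"
  shows "HM1 (A \<otimes> B) (S ||| T)"
proof -
  note A' = A[unfolded HM1_iff] and B' = B[unfolded HM1_iff]
  note US = HM1_cube[OF A] and UT = HM1_cube[OF B]
  have sub: "x \<in> cubes A \<and> deg A x \<le> 1" if "x \<in> cubes (U S)" for x
    using A' that by blast
  have sub': "y \<in> cubes B \<and> deg B y \<le> 1" if "y \<in> cubes (U T)" for y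
    using B' that by blast
  let ?V = "U (S ||| T)"
  have cubes: "(x, y) \<in> cubes ?V \<longleftrightarrow> x \<in> cubes A \<and> y \<in> cubes B \<and> deg A x + deg B y \<le> 1" for x y
  proof -
    have "(x, y) \<in> cubes ?V \<longleftrightarrow>
        x \<in> cubes (U S) \<and> y \<in> cubes (U T) \<and> deg (U S) x + deg (U T) y \<le> 1"
      by (auto simp: interleaving_def tensor_def trunc_def)
    then show ?thesis using US[of x] UT[of y] sub[of x] sub'[of y] by fastforce
  qed
  have props: "deg (A \<otimes> B) (x, y) = deg ?V (x, y) \<and>
      (\<forall>k. \<forall>i \<in> {1..deg (A \<otimes> B) (x, y)}. bd (A \<otimes> B) k i (x, y) = bd ?V k i (x, y)) \<and>
      (deg ?V (x, y) = 1 \<longrightarrow> lab (A \<otimes> B) (x, y) = lab ?V (x, y))"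
    if "(x, y) \<in> cubes ?V" for x y
  proof -
    have "x \<in> cubes A" "y \<in> cubes B" "deg A x + deg B y \<le> 1"
      using that by (auto simp: cubes)
    then have "deg A x \<le> 1" "deg B y \<le> 1" "deg A x = 0 \<or> deg B y = 0" by auto
    then show ?thesis
      using US[OF \<open>x \<in> cubes A\<close>] UT[OF \<open>y \<in> cubes B\<close>]
      by (auto simp: interleaving_def tensor_def)
  qed
  show ?thesis
    unfolding HM1_iff
  proof (intro conjI allI)
    show "init (A \<otimes> B) = init ?V" "final (A \<otimes> B) = final ?V" "labels (A \<otimes> B) = labels ?V"
      using A' B' by (simp_all add: interleaving_def tensor_def)
    show "z \<in> cubes ?V \<longleftrightarrow> z \<in> cubes (A \<otimes> B) \<and> deg (A \<otimes> B) z \<le> 1" for z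
      by (cases z) (auto simp: cubes tensor_def)
  qed (use props in \<open>auto simp: ncubes_def\<close>)
qed

text \<open>A square lying in one factor inherits HM2 from it. In bidegree (1, 1) the face in
  direction 2 carries the label of \<open>x\<close> and the face in direction 1 that of
  \<open>y\<close>, which is the mixed clause of the interleaving.\<close>

lemma HM2_tensor:
  assumes A: "is_hda A" "HM2 A S" and B: "is_hda B" "HM2 B T"
    and labs: "labels A = labels (U S)" "labels B = labels (U T)"
  shows "HM2 (A \<otimes> B) (S ||| T)"
  unfolding HM2_def
proof
  fix z assume "z \<in> ncubes (A \<otimes> B) 2"
  then obtain x y p q where z: "z = (x, y)" "x \<in> ncubes A p" "y \<in> ncubes B q" "p + q = 2"
    by (cases z) (auto simp: ncubes_tensor)
  note degs = ncubes_deg[OF z(2)] ncubes_deg[OF z(3)]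
  note pA = is_hda_precubical[OF A(1)]
  have ltimes_iff: "(Inl \<alpha>, Inl \<alpha>') \<in> ltimes (S ||| T) \<longleftrightarrow> (\<alpha>, \<alpha>') \<in> ltimes S"
    "(Inr \<beta>, Inr \<beta>') \<in> ltimes (S ||| T) \<longleftrightarrow> (\<beta>, \<beta>') \<in> ltimes T"
    "(Inl \<alpha>, Inr \<beta>) \<in> ltimes (S ||| T) \<longleftrightarrow> \<alpha> \<in> labels A \<and> \<beta> \<in> labels B" for \<alpha> \<alpha>' \<beta> \<beta>'
    by (auto simp: interleaving_def labs)
  consider "p = 2" "q = 0" | "p = 1" "q = 1" | "p = 0" "q = 2" using z by linarith
  then show "(lab (A \<otimes> B) (bd (A \<otimes> B) 0 2 z), lab (A \<otimes> B) (bd (A \<otimes> B) 0 1 z)) \<in> ltimes (S ||| T)"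
  proof cases
    case 1
    then show ?thesis
      using z A(2) degs deg_bd[OF pA z(2)] by (simp add: HM2_def bd_tensor lab_tensor ltimes_iff)
  next
    case 2
    then have "lab A x \<in> labels A" "lab B y \<in> labels B"
      using z A(1) B(1) by (auto simp: is_hda_def)
    then show ?thesis
      using 2 z degs deg_bd[OF pA z(2)] by (simp add: bd_tensor lab_tensor ltimes_iff)
  next
    case 3
    then show ?thesis
      using z B(2) degs by (simp add: HM2_def bd_tensor lab_tensor ltimes_iff)
  qed
qed

theorem theorem5p9:
  fixes S :: "('a, 'l) lts" and A :: "('a, 'l) hda"
    and T :: "('b, 'm) lts" and B :: "('b, 'm) hda"
  assumes "ltimes_transition_system S" and "ltimes_transition_system T"
    and "hda_model TYPE('x) A S" and "hda_model TYPE('y) B T"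
  shows "hda_model TYPE('z) (A \<otimes> B) (S ||| T)"
proof -
  have A: "is_hda A" "HM1 A S" "HM2 A S" "HM3 A" "HM4 TYPE('x) A S"
    and B: "is_hda B" "HM1 B T" "HM2 B T" "HM3 B" "HM4 TYPE('y) B T"
    using assms(3,4) by (auto simp: hda_model_def)
  have pre: "precubical A" "precubical B"
    using A(1) B(1) by (simp_all add: is_hda_precubical)
  have ed: "edges_determined A" "edges_determined B"
    using HM1_edges_determined A(2) B(2) assms(1,2)
    by (auto simp: ltimes_transition_system_def)
  have labs: "labels A = labels (U S)" "labels B = labels (U T)"
    using A(2) B(2) by (simp_all add: HM1_iff)
  \<comment> \<open>\<open>fills\<close> mentions no universe type, so it carries HM4 from
    \<open>'x\<close> and \<open>'y\<close> over to \<open>'z\<close>.\<close>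
  have "fills (A \<otimes> B) (ltimes (S ||| T))"
    using pre A(4) ed(1) HM4_fills[OF A] B(4) ed(2) HM4_fills[OF B]
    by (intro fills_tensor[where R = "ltimes S" and Q = "ltimes T"])
      (auto simp: interleaving_def)
  then show ?thesis
    unfolding hda_model_def
    using ltimes_transition_system_interleaving[OF assms(1,2)] is_hda_tensor[OF A(1) B(1)]
      HM1_tensor[OF A(2) B(2)] HM2_tensor[OF A(1,3) B(1,3) labs] HM3_tensor[OF pre A(4) B(4)]
      fills_HM4 by blast
qed

end
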